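(* Let $f,g,h,f_h,D,\mathcal L,p,p_*,r,\psi$ be as in the context. Suppose the following moments over the invariant PDF $p$ of the perturbed system are finite: $$\mathbf E|\mathcal L(\ln r)|<+\infty,\qquad \mathbf E(|h|^2)<+\infty,\qquad \mathbf E(|\psi|^2)<+\infty .$$ Suppose also that the pair $(p,\ln r)$ is $(f_h,D)$-decaying and that the pair $(p_*,r)$ is $(f,D)$-decaying. Then $$\mathbf E(|\psi|^2)\le 4\,\mathbf E(|h|^2).$$
   Context: Setting. Let $f\in C^1(\mathbb R^n,\mathbb R^n)$, $g\in C^2(\mathbb R^n,\mathbb R^{n\times m})$, $h\in C^1(\mathbb R^n,\mathbb R^m)$, and $f_h:=f+gh$, all of these maps being Lipschitz. Let $D(x):=g(x)g(x)^{\mathrm T}$ (the diffusion matrix). The nominal system is the Ito SDE $dX_t=f(X_t)\,dt+g(X_t)\,dV_t$ and the perturbed system is $dX_t=f_h(X_t)\,dt+g(X_t)\,dV_t$, with $V$ an $\mathbb R^m$-valued standard Wiener process. For a matrix-valued $G=(G_{jk})\in C^2(\mathbb R^n,\mathbb S_n)$ ($\mathbb S_n$ = real symmetric matrices of order $n$), $\mathrm{div}\,G:=(\sum_k\partial_{x_k}G_{jk})_{1\le j\le n}$ and $\mathrm{div}^2G:=\sum_{j,k}\partial_{x_j}\partial_{x_k}G_{jk}$. For real matrices, $\langle M,N\rangle_{\mathrm F}:=\mathrm{Tr}(M^{\mathrm T}N)$. For $\varphi\in C^2(\mathbb R^n,\mathbb R)$ with gradient $\nabla\varphi$ and Hessian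 $\varphi''$, $$\mathcal L(\varphi):=f_h^{\mathrm T}\nabla\varphi+\tfrac12\langle D,\varphi''\rangle_{\mathrm F},\qquad \mathcal L^\dagger(\varphi):=\tfrac12\mathrm{div}^2(\varphi D)-\mathrm{div}(\varphi f_h),$$ and $\mathcal L_*^\dagger(\varphi):=\tfrac12\mathrm{div}^2(\varphi D)-\mathrm{div}(\varphi f)$. Invariant PDFs. $p$ and $p_*$ are the (assumed to exist and to be unique) $C^2$ probability density functions on $\mathbb R^n$ satisfying $\mathcal L^\dagger(p)=0$ (perturbed system) and $\mathcal L_*^\dagger(p_* )=0$ (nominal system); both are assumed positive everywhere. Put $r:=p/p_*$ and $\psi(x):=g(x)^{\mathrm T}\nabla\ln r(x)\in\mathbb R^m$. $\mathbf E(\cdot)$ is the expectation over $p$, i.e. $\mathbf E\varphi=\int_{\mathbb R^n}\varphi(x)p(x)\,dx$. Definition (decaying pair). For $\phi\in C^1(\mathbb R^n,\mathbb R^n)$ and $G\in C^2(\mathbb R^n,\mathbb S_n)$, a pair $(u,v)$ of functions $u,v\in C^2(\mathbb R^n,\mathbb R)$ is called $(\phi,G)$-decaying if $$\Big(\phi-\tfrac12\mathrm{div}\,G\Big)uv+\tfrac12G(u\nabla v-v\nabla u)=o(|x|^{1-n})\quad\text{as }x\to\infty .$$ *)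

theory Defs
  imports "HOL-Analysis.Analysis" "HOL-Library.Landau_Symbols"
begin

definition C1 :: "('a::real_normed_vector \<Rightarrow> 'b::real_normed_vector) \<Rightarrow> bool" where
  "C1 F \<longleftrightarrow> (\<exists>F' :: 'a \<Rightarrow> 'a \<Rightarrow>\<^sub>L 'b.
     (\<forall>x. (F has_derivative blinfun_apply (F' x)) (at x)) \<and> continuous_on UNIV F')"

definition C2 :: "('a::real_normed_vector \<Rightarrow> 'b::real_normed_vector) \<Rightarrow> bool" where
  "C2 F \<longleftrightarrow> (\<exists>F' :: 'a \<Rightarrow> 'a \<Rightarrow>\<^sub>L 'b.
     (\<forall>x. (F has_derivative blinfun_apply (F' x)) (at x)) \<and> C1 F')"

definition partial :: "'n::finite \<Rightarrow> (real ^ 'n \<Rightarrow> real) \<Rightarrow> real ^ 'n \<Rightarrow> real" where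
  "partial k \<phi> x = deriv (\<lambda>t. \<phi> (x + t *\<^sub>R axis k 1)) 0"

definition gradient :: "(real ^ 'n::finite \<Rightarrow> real) \<Rightarrow> real ^ 'n \<Rightarrow> real ^ 'n" where
  "gradient \<phi> x = (\<chi> k. partial k \<phi> x)"

definition hessian :: "(real ^ 'n::finite \<Rightarrow> real) \<Rightarrow> real ^ 'n \<Rightarrow> real ^ 'n ^ 'n" where
  "hessian \<phi> x = (\<chi> j k. partial j (partial k \<phi>) x)"

definition divergence :: "(real ^ 'n::finite \<Rightarrow> real ^ 'n) \<Rightarrow> real ^ 'n \<Rightarrow> real" where
  "divergence F x = (\<Sum>k\<in>UNIV. partial k (\<lambda>y. F y $ k) x)"

definition mat_div :: "(real ^ 'n::finite \<Rightarrow> real ^ 'n ^ 'n) \<Rightarrow> real ^ 'n \<Rightarrow> real ^ 'n" where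
  "mat_div G x = (\<chi> j. \<Sum>k\<in>UNIV. partial k (\<lambda>y. G y $ j $ k) x)"

definition mat_div2 :: "(real ^ 'n::finite \<Rightarrow> real ^ 'n ^ 'n) \<Rightarrow> real ^ 'n \<Rightarrow> real" where
  "mat_div2 G x = (\<Sum>j\<in>UNIV. \<Sum>k\<in>UNIV. partial j (partial k (\<lambda>y. G y $ j $ k)) x)"

definition frobenius :: "real ^ 'n ^ 'm::finite \<Rightarrow> real ^ 'n::finite ^ 'm \<Rightarrow> real" where
  "frobenius M N = trace (transpose M ** N)"

text \<open>An \<open>n \<times> m\<close> matrix has type \<open>real ^ 'm ^ 'n\<close>.\<close>

definition perturbed_drift ::
  "(real ^ 'n \<Rightarrow> real ^ 'n) \<Rightarrow> (real ^ 'n \<Rightarrow> real ^ 'm ^ 'n) \<Rightarrow> (real ^ 'n \<Rightarrow> real ^ 'm)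
    \<Rightarrow> real ^ 'n::finite \<Rightarrow> real ^ 'n" where
  "perturbed_drift f g h x = f x + g x *v h x"

definition diffusion_matrix ::
  "(real ^ 'n::finite \<Rightarrow> real ^ 'm::finite ^ 'n) \<Rightarrow> real ^ 'n \<Rightarrow> real ^ 'n ^ 'n" where
  "diffusion_matrix g x = g x ** transpose (g x)"

definition generator ::
  "(real ^ 'n::finite \<Rightarrow> real ^ 'n) \<Rightarrow> (real ^ 'n \<Rightarrow> real ^ 'n ^ 'n) \<Rightarrow> (real ^ 'n \<Rightarrow> real)
    \<Rightarrow> real ^ 'n \<Rightarrow> real" where
  "generator b D \<phi> x = b x \<bullet> gradient \<phi> x + 1 / 2 * frobenius (D x) (hessian \<phi> x)"

definition adjoint_generator ::
  "(real ^ 'n::finite \<Rightarrow> real ^ 'n) \<Rightarrow> (real ^ 'n \<Rightarrow> real ^ 'n ^ 'n) \<Rightarrow> (real ^ 'n \<Rightarrow> real)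
    \<Rightarrow> real ^ 'n \<Rightarrow> real" where
  "adjoint_generator b D \<phi> x =
     1 / 2 * mat_div2 (\<lambda>y. \<phi> y *\<^sub>R D y) x - divergence (\<lambda>y. \<phi> y *\<^sub>R b y) x"

definition prob_density :: "(real ^ 'n::finite \<Rightarrow> real) \<Rightarrow> bool" where
  "prob_density q \<longleftrightarrow> (\<forall>x. 0 \<le> q x) \<and> integrable lborel q \<and> (LINT x|lborel. q x) = 1"

definition invariant_pdf ::
  "(real ^ 'n::finite \<Rightarrow> real ^ 'n) \<Rightarrow> (real ^ 'n \<Rightarrow> real ^ 'n ^ 'n) \<Rightarrow> (real ^ 'n \<Rightarrow> real) \<Rightarrow> bool"
  where
  "invariant_pdf b D q \<longleftrightarrow>
     C2 q \<and> prob_density q \<and> (\<forall>x. adjoint_generator b D q x = 0)"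

definition unique_invariant_pdf ::
  "(real ^ 'n::finite \<Rightarrow> real ^ 'n) \<Rightarrow> (real ^ 'n \<Rightarrow> real ^ 'n ^ 'n) \<Rightarrow> (real ^ 'n \<Rightarrow> real) \<Rightarrow> bool"
  where
  "unique_invariant_pdf b D q \<longleftrightarrow>
     invariant_pdf b D q \<and> (\<forall>q'. invariant_pdf b D q' \<longrightarrow> q' = q)"

definition density_ratio :: "('a \<Rightarrow> real) \<Rightarrow> ('a \<Rightarrow> real) \<Rightarrow> 'a \<Rightarrow> real" where
  "density_ratio p p0 x = p x / p0 x"

definition psi ::
  "(real ^ 'n::finite \<Rightarrow> real ^ 'm::finite ^ 'n) \<Rightarrow> (real ^ 'n \<Rightarrow> real) \<Rightarrow> (real ^ 'n \<Rightarrow> real)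
    \<Rightarrow> real ^ 'n \<Rightarrow> real ^ 'm" where
  "psi g p p0 x = transpose (g x) *v gradient (\<lambda>y. ln (density_ratio p p0 y)) x"

definition has_finite_mean :: "(real ^ 'n::finite \<Rightarrow> real) \<Rightarrow> (real ^ 'n \<Rightarrow> real) \<Rightarrow> bool" where
  "has_finite_mean p \<phi> \<longleftrightarrow> integrable lborel (\<lambda>x. \<phi> x * p x)"

definition mean :: "(real ^ 'n::finite \<Rightarrow> real) \<Rightarrow> (real ^ 'n \<Rightarrow> real) \<Rightarrow> real" where
  "mean p \<phi> = (LINT x|lborel. \<phi> x * p x)"

text \<open>The Landau symbol is only available for field-valued functions, hence the norm on the
  left. The exponent \<open>1 - n\<close> may be zero or negative.\<close>

definition decaying_pair ::
  "(real ^ 'n::finite \<Rightarrow> real ^ 'n) \<Rightarrow> (real ^ 'n \<Rightarrow> real ^ 'n ^ 'n)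
    \<Rightarrow> (real ^ 'n \<Rightarrow> real) \<Rightarrow> (real ^ 'n \<Rightarrow> real) \<Rightarrow> bool" where
  "decaying_pair \<phi> G u v \<longleftrightarrow> C2 u \<and> C2 v \<and>
     (\<lambda>x. norm ((u x * v x) *\<^sub>R (\<phi> x - (1 / 2) *\<^sub>R mat_div G x)
        + (1 / 2) *\<^sub>R (G x *v (u x *\<^sub>R gradient v x - v x *\<^sub>R gradient u x))))
     \<in> o[at_infinity](\<lambda>x. norm x powr (1 - real CARD('n)))"

end

theory Submission imports Defs begin

text \<open>For the flux \<open>F = (b - div G / 2) u v + G (u \<nabla>v - v \<nabla>u) / 2\<close> one has
  \<open>div F = u L(v) - v L\<^sup>\<dagger>(u)\<close>, so for a decaying pair with \<open>L\<^sup>\<dagger>(u) = 0\<close> the integral of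
  \<open>u L(v)\<close> vanishes. The pair \<open>(p, ln r)\<close> gives \<open>E L(ln r) = 0\<close>. Since \<open>r = exp (ln r)\<close>,
  the nominal generator satisfies \<open>p\<^sub>* L\<^sub>*(r) = p (L(ln r) - h\<^sup>T \<psi> + |\<psi>|\<^sup>2 / 2)\<close>, so the pair
  \<open>(p\<^sub>*, r)\<close> gives \<open>E |\<psi>|\<^sup>2 = 2 E h\<^sup>T \<psi>\<close>, and \<open>h\<^sup>T \<psi> \<le> |h|\<^sup>2 + |\<psi>|\<^sup>2 / 4\<close> concludes.
  The divergence theorem is obtained without surface integrals, by multiplying with the
  cutoff \<open>\<chi>(|x|\<^sup>2 / R\<^sup>2)\<close> and letting \<open>R\<close> tend to infinity.\<close>

subsection \<open>Axis-wise differentiability\<close>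

text \<open>\<open>deriv\<close> has a value even where no derivative exists, so differentiability
  along every axis is demanded explicitly. The differential operators see only these partial
  derivatives, and the notion passes to sums and products without Frechet derivatives.\<close>

definition partially_C1 :: "(real ^ 'n::finite \<Rightarrow> real) \<Rightarrow> bool" where
  "partially_C1 \<phi> \<longleftrightarrow> continuous_on UNIV \<phi> \<and>
     (\<forall>k. continuous_on UNIV (partial k \<phi>) \<and>
       (\<forall>x. ((\<lambda>t. \<phi> (x + t *\<^sub>R axis k 1)) has_real_derivative partial k \<phi> x) (at 0)))"

definition partially_C2 :: "(real ^ 'n::finite \<Rightarrow> real) \<Rightarrow> bool" where
  "partially_C2 \<phi> \<longleftrightarrow> partially_C1 \<phi> \<and> (\<forall>k. partially_C1 (partial k \<phi>))"

lemma partial_eqI: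
  "((\<lambda>t. \<phi> (x + t *\<^sub>R axis k 1)) has_real_derivative d) (at 0) \<Longrightarrow> partial k \<phi> x = d"
  unfolding partial_def by (rule DERIV_imp_deriv)

lemma partially_C1I:
  assumes "continuous_on UNIV \<phi>" "\<And>k. continuous_on UNIV (\<phi>' k)"
    and d: "\<And>k x. ((\<lambda>t. \<phi> (x + t *\<^sub>R axis k 1)) has_real_derivative \<phi>' k x) (at 0)"
  shows "partially_C1 \<phi>"
proof -
  have "partial k \<phi> = \<phi>' k" for k using partial_eqI[OF d] by blast
  with assms show ?thesis by (simp add: partially_C1_def)
qed

lemma partially_C1D:
  assumes "partially_C1 \<phi>"
  shows "continuous_on UNIV \<phi>" "continuous_on UNIV (partial k \<phi>)"
    "((\<lambda>t. \<phi> (x + t *\<^sub>R axis k 1)) has_real_derivative partial k \<phi> x) (at 0)"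
  using assms by (auto simp: partially_C1_def)

lemma partially_C2D:
  assumes "partially_C2 \<phi>"
  shows "partially_C1 \<phi>" "partially_C1 (partial k \<phi>)"
  using assms by (auto simp: partially_C2_def)

section \<open>From Frechet derivatives to continuous partial derivatives\<close>

lemma has_derivative_along_axis:
  fixes \<phi> :: "real ^ 'n::finite \<Rightarrow> real"
  assumes "(\<phi> has_derivative \<phi>') (at x)"
  shows "((\<lambda>t. \<phi> (x + t *\<^sub>R axis k 1)) has_real_derivative \<phi>' (axis k 1)) (at 0)"
proof -
  have lin: "linear \<phi>'" using assms has_derivative_linear by blast
  have "((\<lambda>t. x + t *\<^sub>R axis k 1) has_derivative (\<lambda>t. t *\<^sub>R axis k 1)) (at (0::real))"
    by (auto intro!: derivative_eq_intros)
  then have "((\<lambda>t. \<phi> (x + t *\<^sub>R axis k 1)) has_derivative (\<lambda>t. \<phi>' (t *\<^sub>R axis k 1))) (at 0)"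
    by (rule has_derivative_compose) (simp add: assms)
  then show ?thesis
    by (simp add: has_field_derivative_def linear_cmul[OF lin] mult_commute_abs)
qed

text \<open>A bounded linear map is its own derivative, so the chain rule only composes the old
  derivative with \<open>Blinfun l\<close>. This serves to pick out components of vectors and to
  evaluate derivatives at basis vectors.\<close>

lemma C1_bounded_linear:
  assumes "C1 \<phi>" "bounded_linear l"
  shows "C1 (\<lambda>x. l (\<phi> x))"
proof -
  obtain \<phi>' where d: "\<And>x. (\<phi> has_derivative blinfun_apply (\<phi>' x)) (at x)"
    and c: "continuous_on UNIV \<phi>'"
    using assms(1) by (auto simp: C1_def)
  have "((\<lambda>x. l (\<phi> x)) has_derivative blinfun_apply (Blinfun l o\<^sub>L \<phi>' x)) (at x)" for x
    using bounded_linear.has_derivative[OF assms(2) d[of x]]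
    by (simp add: blinfun_apply_blinfun_compose[abs_def] bounded_linear_Blinfun_apply[OF assms(2)])
  moreover have "continuous_on UNIV (\<lambda>x. Blinfun l o\<^sub>L \<phi>' x)"
    by (intro continuous_intros c)
  ultimately show ?thesis unfolding C1_def by (intro exI[of _ "\<lambda>x. Blinfun l o\<^sub>L \<phi>' x"]) auto
qed

text \<open>Composition with \<open>Blinfun l\<close> is again bounded linear, now on the space of
  derivatives, so the C^1 case applies to the derivative itself.\<close>

lemma C2_bounded_linear:
  assumes "C2 \<phi>" "bounded_linear l"
  shows "C2 (\<lambda>x. l (\<phi> x))"
proof -
  obtain \<phi>' where d: "\<And>x. (\<phi> has_derivative blinfun_apply (\<phi>' x)) (at x)" and c: "C1 \<phi>'"
    using assms(1) by (auto simp: C2_def)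
  have "((\<lambda>x. l (\<phi> x)) has_derivative blinfun_apply (Blinfun l o\<^sub>L \<phi>' x)) (at x)" for x
    using bounded_linear.has_derivative[OF assms(2) d[of x]]
    by (simp add: blinfun_apply_blinfun_compose[abs_def] bounded_linear_Blinfun_apply[OF assms(2)])
  moreover have "C1 (\<lambda>x. Blinfun l o\<^sub>L \<phi>' x)"
    by (intro C1_bounded_linear[OF c] bounded_bilinear.bounded_linear_right
        bounded_bilinear_blinfun_compose)
  ultimately show ?thesis unfolding C2_def by (intro exI[of _ "\<lambda>x. Blinfun l o\<^sub>L \<phi>' x"]) auto
qed

lemma C1_imp_partially_C1:
  assumes "C1 \<phi>"
  shows "partially_C1 \<phi>"
proof -
  obtain \<phi>' where d: "\<And>x. (\<phi> has_derivative blinfun_apply (\<phi>' x)) (at x)"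
    and c: "continuous_on UNIV \<phi>'"
    using assms(1) by (auto simp: C1_def)
  show ?thesis
  proof (rule partially_C1I[OF _ _ has_derivative_along_axis[OF d]])
    show "continuous_on UNIV \<phi>"
      using has_derivative_continuous[OF d] by (simp add: continuous_on_eq_continuous_at)
    show "continuous_on UNIV (\<lambda>x. blinfun_apply (\<phi>' x) (axis k 1))" for k
      by (intro continuous_intros c)
  qed
qed

text \<open>Evaluation at \<open>axis k 1\<close> is bounded linear on derivatives, so each partial
  derivative inherits C^1 from the Frechet derivative.\<close>

lemma C2_imp_partially_C2:
  assumes "C2 \<phi>"
  shows "partially_C2 \<phi>"
proof -
  obtain \<phi>' where d: "\<And>x. (\<phi> has_derivative blinfun_apply (\<phi>' x)) (at x)" and c: "C1 \<phi>'"
    using assms(1) by (auto simp: C2_def)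
  have "C1 \<phi>"
    using d c by (auto simp: C1_def intro!: exI[of _ \<phi>'] has_derivative_continuous
        simp: continuous_on_eq_continuous_at)
  moreover have "partial k \<phi> = (\<lambda>x. blinfun_apply (\<phi>' x) (axis k 1))" for k
    using partial_eqI[OF has_derivative_along_axis[OF d]] by blast
  moreover have "C1 (\<lambda>x. blinfun_apply (\<phi>' x) (axis k 1))" for k
    by (intro C1_bounded_linear[OF c] bounded_linear_intros)
  ultimately show ?thesis by (simp add: partially_C2_def C1_imp_partially_C1)
qed

section \<open>Product, sum and chain rules for partial derivatives\<close>

lemma partial_mult:
  assumes "partially_C1 u" "partially_C1 v"
  shows "partial k (\<lambda>x. u x * v x) = (\<lambda>x. partial k u x * v x + u x * partial k v x)"
  by (rule ext, rule partial_eqI)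
    (auto intro!: derivative_eq_intros partially_C1D(3) assms)

lemma partially_C1_mult:
  assumes "partially_C1 u" "partially_C1 v"
  shows "partially_C1 (\<lambda>x. u x * v x)"
  using assms
  by (intro partially_C1I[where \<phi>' = "\<lambda>k x. partial k u x * v x + u x * partial k v x"])
    (auto intro!: derivative_eq_intros continuous_intros partially_C1D(3) dest: partially_C1D)

lemma partial_add:
  assumes "partially_C1 u" "partially_C1 v"
  shows "partial k (\<lambda>x. u x + v x) = (\<lambda>x. partial k u x + partial k v x)"
  by (rule ext, rule partial_eqI)
    (auto intro!: derivative_eq_intros partially_C1D(3) assms)

lemma partially_C1_add:
  assumes "partially_C1 u" "partially_C1 v"
  shows "partially_C1 (\<lambda>x. u x + v x)"
  using assms
  by (intro partially_C1I[where \<phi>' = "\<lambda>k x. partial k u x + partial k v x"])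
    (auto intro!: derivative_eq_intros continuous_intros partially_C1D(3) dest: partially_C1D)

lemma partially_C1_const: "partially_C1 (\<lambda>x. c)"
  by (rule partially_C1I[where \<phi>' = "\<lambda>k x. 0"]) auto

lemma partial_const: "partial k (\<lambda>x. c) = (\<lambda>x. 0)"
  by (rule ext, rule partial_eqI) auto

lemma partial_sum:
  assumes "\<And>i. i \<in> I \<Longrightarrow> partially_C1 (u i)"
  shows "partial k (\<lambda>x. \<Sum>i\<in>I. u i x) = (\<lambda>x. \<Sum>i\<in>I. partial k (u i) x)"
  by (rule ext, rule partial_eqI)
    (auto intro!: derivative_eq_intros partially_C1D(3) assms)

lemma partially_C1_sum:
  assumes "\<And>i. i \<in> I \<Longrightarrow> partially_C1 (u i)"
  shows "partially_C1 (\<lambda>x. \<Sum>i\<in>I. u i x)"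
  using assms
  by (intro partially_C1I[where \<phi>' = "\<lambda>k x. \<Sum>i\<in>I. partial k (u i) x"])
    (auto intro!: derivative_eq_intros continuous_intros partially_C1D(3) dest: partially_C1D)

lemma partially_C2_mult:
  assumes "partially_C2 u" "partially_C2 v"
  shows "partially_C2 (\<lambda>x. u x * v x)"
  using assms
  by (auto simp: partially_C2_def partial_mult intro!: partially_C1_mult partially_C1_add)

lemma partially_C2_sum:
  assumes "\<And>i. i \<in> I \<Longrightarrow> partially_C2 (u i)"
  shows "partially_C2 (\<lambda>x. \<Sum>i\<in>I. u i x)"
  using assms
  by (auto simp: partially_C2_def partial_sum intro!: partially_C1_sum)

lemma compose_along_axis:
  assumes "partially_C1 \<phi>" "\<And>s. (\<theta> has_real_derivative \<theta>' s) (at s)"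
  shows "((\<lambda>t. \<theta> (\<phi> (x + t *\<^sub>R axis k 1))) has_real_derivative \<theta>' (\<phi> x) * partial k \<phi> x) (at 0)"
  using DERIV_chain2[OF assms(2) partially_C1D(3)[OF assms(1)]] by simp

lemma partial_compose:
  assumes "partially_C1 \<phi>" "\<And>s. (\<theta> has_real_derivative \<theta>' s) (at s)"
  shows "partial k (\<lambda>x. \<theta> (\<phi> x)) = (\<lambda>x. \<theta>' (\<phi> x) * partial k \<phi> x)"
  using partial_eqI[OF compose_along_axis[OF assms]] by blast

lemma partially_C1_compose:
  assumes \<phi>: "partially_C1 \<phi>" and \<theta>: "\<And>s. (\<theta> has_real_derivative \<theta>' s) (at s)"
    and \<theta>': "continuous_on UNIV \<theta>'"
  shows "partially_C1 (\<lambda>x. \<theta> (\<phi> x))"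
proof (rule partially_C1I[OF _ _ compose_along_axis[OF \<phi> \<theta>]])
  have "continuous_on UNIV \<theta>" using DERIV_isCont[OF \<theta>] by (simp add: continuous_on_eq_continuous_at)
  then show "continuous_on UNIV (\<lambda>x. \<theta> (\<phi> x))"
    using continuous_on_compose2 partially_C1D(1)[OF \<phi>] by blast
  have "continuous_on UNIV (\<lambda>x. \<theta>' (\<phi> x))"
    using \<theta>' continuous_on_compose2 partially_C1D(1)[OF \<phi>] by blast
  then show "continuous_on UNIV (\<lambda>x. \<theta>' (\<phi> x) * partial k \<phi> x)" for k
    using partially_C1D(2)[OF \<phi>] by (intro continuous_intros)
qed

text \<open>The squared norm is differentiable at the origin too, so a radial cutoff built on it
  needs no case distinction in the chain rule.\<close>

lemma inner_self_partial:
  shows "partially_C1 (\<lambda>x::real ^ 'n::finite. x \<bullet> x)"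
    and "partial k (\<lambda>x::real ^ 'n::finite. x \<bullet> x) x = 2 * x $ k"
proof -
  have d: "((\<lambda>t. (x + t *\<^sub>R axis k 1) \<bullet> (x + t *\<^sub>R axis k 1)) has_real_derivative 2 * x $ k) (at 0)"
    for x :: "real ^ 'n" and k
    using has_derivative_along_axis[OF has_derivative_inner[OF has_derivative_ident has_derivative_ident],
        of x k] by (simp add: inner_axis inner_axis')
  show "partially_C1 (\<lambda>x::real ^ 'n. x \<bullet> x)"
    by (rule partially_C1I[OF _ _ d]) (intro continuous_intros)+
  show "partial k (\<lambda>x::real ^ 'n. x \<bullet> x) x = 2 * x $ k" by (rule partial_eqI[OF d])
qed

subsection \<open>Vanishing integrals of divergences\<close>

text \<open>Moves the base point from 0 to \<open>t\<close>, as the mean value theorem along an axis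
  requires.\<close>

lemma partial_along_axis:
  assumes "partially_C1 \<phi>"
  shows "((\<lambda>s. \<phi> (x + s *\<^sub>R axis k 1)) has_real_derivative partial k \<phi> (x + t *\<^sub>R axis k 1)) (at t)"
proof -
  have "((\<lambda>s. \<phi> ((x + t *\<^sub>R axis k 1) + s *\<^sub>R axis k 1)) has_real_derivative
      partial k \<phi> (x + t *\<^sub>R axis k 1)) (at 0)"
    by (rule partially_C1D(3)[OF assms])
  moreover have "(x + t *\<^sub>R axis k 1) + s *\<^sub>R axis k 1 = x + (s + t) *\<^sub>R axis k 1" for s
    by (simp add: algebra_simps)
  ultimately show ?thesis
    using DERIV_shift[of "\<lambda>s. \<phi> (x + s *\<^sub>R axis k 1)" _ 0 t] by simp
qed

text \<open>The difference quotients have integral zero by translation invariance and converge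
  dominatedly.\<close>

lemma integral_partial_compact_support:
  fixes \<phi> :: "real ^ 'n::finite \<Rightarrow> real"
  assumes \<phi>: "partially_C1 \<phi>" and supp: "\<And>x. R \<le> norm x \<Longrightarrow> \<phi> x = 0"
  shows "integrable lborel (partial k \<phi>)" and "(LINT x|lborel. partial k \<phi> x) = 0"
proof -
  let ?e = "axis k 1 :: real ^ 'n"
  \<comment> \<open>The difference quotients below have step at most 1, so radius
    \<open>R + 1\<close> contains all their supports.\<close>
  let ?K = "cball 0 (R + 1) :: (real ^ 'n) set"
  define s where "s i x = (\<phi> (x + (1 / real (Suc i)) *\<^sub>R ?e) - \<phi> x) / (1 / real (Suc i))" for i x
  have meas: "\<phi> \<in> borel_measurable borel" "partial k \<phi> \<in> borel_measurable borel"
    by (auto intro!: borel_measurable_continuous_onI partially_C1D \<phi>)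
  \<comment> \<open>The strict inequality is an open condition, so the function vanishes for all
    small \<open>t\<close> and not only at \<open>t = 0\<close>.\<close>
  have zero: "partial k \<phi> x = 0" if "R < norm x" for x
  proof (rule partial_eqI)
    have "(\<lambda>t. x + t *\<^sub>R ?e) \<midarrow>0\<rightarrow> x + 0 *\<^sub>R ?e" by (intro tendsto_intros)
    then have "\<forall>\<^sub>F t in at 0. R < norm (x + t *\<^sub>R ?e)"
      using order_tendstoD(1)[OF tendsto_norm] that by force
    then have "\<forall>\<^sub>F t in nhds 0. \<phi> (x + t *\<^sub>R ?e) = 0"
      using supp that by (auto simp: eventually_nhds_conv_at elim!: eventually_mono)
    then show "((\<lambda>t. \<phi> (x + t *\<^sub>R ?e)) has_real_derivative 0) (at 0)"
      using DERIV_cong_ev[of 0 0 "\<lambda>t. \<phi> (x + t *\<^sub>R ?e)" "\<lambda>t. 0" 0 0] by simp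
  qed
  have "bounded (partial k \<phi> ` ?K)"
    by (intro compact_imp_bounded compact_continuous_image compact_cball)
      (rule continuous_on_subset[OF partially_C1D(2)[OF \<phi>]], simp)
  then obtain M where M: "\<forall>y\<in>partial k \<phi> ` ?K. norm y \<le> M" and "0 < M"
    unfolding bounded_pos by blast
  have M': "\<bar>partial k \<phi> x\<bar> \<le> M" for x
  proof (cases "R < norm x")
    case False
    then show ?thesis using M[rule_format, OF imageI, of x] by simp
  qed (use zero \<open>0 < M\<close> in simp)
  have bound: "norm (s i x) \<le> M * indicator ?K x" for i x
  proof (cases "x \<in> ?K")
    case True
    \<comment> \<open>By the mean value theorem a difference quotient is a value of the partial
      derivative, hence bounded by \<open>M\<close> uniformly in \<open>i\<close>.\<close>
    have "\<exists>z. 0 < z \<and> z < 1 / real (Suc i) \<and>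
        \<phi> (x + (1 / real (Suc i)) *\<^sub>R ?e) - \<phi> (x + 0 *\<^sub>R ?e)
        = (1 / real (Suc i) - 0) * partial k \<phi> (x + z *\<^sub>R ?e)"
      by (rule MVT2) (auto intro: partial_along_axis[OF \<phi>])
    then obtain z where "s i x = partial k \<phi> (x + z *\<^sub>R ?e)"
      by (auto simp: s_def)
    with True M' show ?thesis by simp
  next
    case False
    have "norm x \<le> norm (x + (1 / real (Suc i)) *\<^sub>R ?e) + norm ((1 / real (Suc i)) *\<^sub>R ?e)"
      by (metis add_diff_cancel_right' norm_triangle_ineq4)
    moreover have "norm ((1 / real (Suc i)) *\<^sub>R ?e) \<le> 1" by simp
    moreover have "R + 1 < norm x" using False by simp
    ultimately have "R \<le> norm (x + (1 / real (Suc i)) *\<^sub>R ?e)" by linarith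
    then show ?thesis using False supp by (simp add: s_def)
  qed
  have lim: "(\<lambda>i. s i x) \<longlonglongrightarrow> partial k \<phi> x" for x
  proof -
    have "((\<lambda>h. (\<phi> (x + h *\<^sub>R ?e) - \<phi> x) / h) \<longlongrightarrow> partial k \<phi> x) (at 0)"
      using partially_C1D(3)[OF \<phi>, of x k] by (simp add: DERIV_def)
    moreover have "filterlim (\<lambda>i. 1 / real (Suc i)) (at 0) sequentially"
      unfolding filterlim_at using LIMSEQ_inverse_real_of_nat by (auto simp: field_simps)
    ultimately show ?thesis unfolding s_def by (rule filterlim_compose)
  qed
  have "emeasure lborel ?K < \<infinity>" by (rule emeasure_lborel_cball_finite)
  then have indicator_int: "integrable lborel (\<lambda>x. indicator ?K x :: real)"
    by (intro integrable_real_indicator) auto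
  then have K: "integrable lborel (\<lambda>x. c * indicator ?K x :: real)" for c
    by (rule integrable_mult_right)
  have ms: "s i \<in> borel_measurable lborel" for i
    unfolding s_def using meas(1) by measurable
  have "bounded (\<phi> ` ?K)"
    by (intro compact_imp_bounded compact_continuous_image compact_cball)
      (rule continuous_on_subset[OF partially_C1D(1)[OF \<phi>]], simp)
  then obtain B where B: "\<forall>y\<in>\<phi> ` ?K. norm y \<le> B"
    unfolding bounded_pos by blast
  have \<phi>_bound: "norm (\<phi> x) \<le> norm (B * indicator ?K x)" for x
  proof (cases "x \<in> ?K")
    case True
    then show ?thesis using B[rule_format, OF imageI, of x] by simp
  qed (use supp in simp)
  have \<phi>_int: "integrable lborel \<phi>"
    by (rule Bochner_Integration.integrable_bound[OF K[of B] _ AE_I2[OF \<phi>_bound]]) (simp add: meas(1))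
  have shift: "integrable lborel (\<lambda>x. \<phi> (x + c))" "(LINT x|lborel. \<phi> (x + c)) = (LINT x|lborel. \<phi> x)" for c
    using \<phi>_int meas(1) integrable_distr_eq[of "(+) c" lborel borel \<phi>]
      integral_distr[of "(+) c" lborel borel \<phi>]
    by (simp_all add: lborel_distr_plus add.commute[of _ c])
  have "(LINT x|lborel. s i x) = 0" for i
    unfolding s_def using \<phi>_int shift by (simp del: of_nat_Suc)
  moreover have "(\<lambda>i. LINT x|lborel. s i x) \<longlonglongrightarrow> (LINT x|lborel. partial k \<phi> x)"
    by (rule integral_dominated_convergence[where s = s, OF _ ms K]) (use meas lim bound in auto)
  ultimately show "(LINT x|lborel. partial k \<phi> x) = 0"
    by (simp add: LIMSEQ_const_iff)
  show "integrable lborel (partial k \<phi>)"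
    by (rule integrable_dominated_convergence[where s = s, OF _ ms K]) (use meas lim bound in auto)
qed


section \<open>A radial C^1 cutoff and the divergence theorem on the whole space\<close>

lemma has_real_derivative_max_0_power2:
  "((\<lambda>t. (max 0 t)\<^sup>2) has_real_derivative 2 * max 0 t) (at (t::real))"
proof -
  consider "t > 0" | "t < 0" | "t = 0" by linarith
  then show ?thesis
  proof cases
    case 1
    have "((\<lambda>t. t\<^sup>2) has_real_derivative 2 * max 0 t) (at t)"
      using 1 by (auto intro!: derivative_eq_intros)
    then show ?thesis
      by (rule has_field_derivative_transform_within_open[of _ _ _ "{0<..}"]) (use 1 in auto)
  next
    case 2
    have "((\<lambda>t. 0) has_real_derivative 2 * max 0 t) (at t)"
      using 2 by (auto intro!: derivative_eq_intros)
    then show ?thesis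
      by (rule has_field_derivative_transform_within_open[of _ _ _ "{..<0}"]) (use 2 in auto)
  next
    case 3
    \<comment> \<open>Squaring flattens the corner of the positive part: the difference quotient at
      0 is at most |h|.\<close>
    have "((\<lambda>h::real. (max 0 h)\<^sup>2 / h) \<longlongrightarrow> 0) (at 0)"
    proof (rule Lim_null_comparison)
      show "\<forall>\<^sub>F h in at 0. norm ((max 0 h)\<^sup>2 / h) \<le> \<bar>h\<bar>"
        by (rule always_eventually) (auto simp: max_def power2_eq_square)
      show "((\<lambda>h. \<bar>h\<bar>) \<longlongrightarrow> 0) (at (0::real))"
        by (intro tendsto_eq_intros) auto
    qed
    then show ?thesis by (simp add: DERIV_def 3)
  qed
qed

text \<open>Two squared positive parts glue the constants 1 on s \<le> 1 and 0 on s \<ge> 2 by (1 -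
  (s - 1)^2)^2. The result is C^1, which fits its use: it is differentiated only once.\<close>

definition cutoff :: "real \<Rightarrow> real" where
  "cutoff s = (max 0 (1 - (max 0 (s - 1))\<^sup>2))\<^sup>2"

definition cutoff' :: "real \<Rightarrow> real" where
  "cutoff' s = - 4 * max 0 (1 - (max 0 (s - 1))\<^sup>2) * max 0 (s - 1)"

lemma cutoff_deriv: "(cutoff has_real_derivative cutoff' s) (at s)"
proof -
  have "((\<lambda>s. 1 - (max 0 (s - 1))\<^sup>2) has_real_derivative - (2 * max 0 (s - 1))) (at s)"
    by (rule derivative_eq_intros DERIV_chain2[OF has_real_derivative_max_0_power2] refl)+ simp
  from DERIV_chain2[OF has_real_derivative_max_0_power2 this] show ?thesis
    by (simp add: cutoff_def[abs_def] cutoff'_def algebra_simps)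
qed

lemma continuous_on_cutoff': "continuous_on A cutoff'"
  unfolding cutoff'_def[abs_def] by (intro continuous_intros)

lemma one_le_power2_max: "2 \<le> s \<Longrightarrow> 1 \<le> (max 0 (s - 1 :: real))\<^sup>2"
  by (simp add: max_def)

lemma cutoff_props:
  "s \<le> 1 \<Longrightarrow> cutoff s = 1" "2 \<le> s \<Longrightarrow> cutoff s = 0" "\<bar>cutoff s\<bar> \<le> 1"
  "s \<le> 1 \<Longrightarrow> cutoff' s = 0" "2 \<le> s \<Longrightarrow> cutoff' s = 0" "\<bar>cutoff' s\<bar> \<le> 4"
proof -
  let ?m = "max 0 (1 - (max 0 (s - 1))\<^sup>2)"
  have m: "0 \<le> ?m" "?m \<le> 1" by auto
  show "s \<le> 1 \<Longrightarrow> cutoff s = 1" "s \<le> 1 \<Longrightarrow> cutoff' s = 0"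
    by (simp_all add: cutoff_def cutoff'_def max_def)
  show "2 \<le> s \<Longrightarrow> cutoff s = 0" and z: "2 \<le> s \<Longrightarrow> cutoff' s = 0"
    using one_le_power2_max[of s] by (simp_all add: cutoff_def cutoff'_def)
  show "\<bar>cutoff s\<bar> \<le> 1"
    using m by (simp add: cutoff_def power_le_one)
  show "\<bar>cutoff' s\<bar> \<le> 4"
  \<comment> \<open>Below 2 both non-constant factors of \<open>cutoff'\<close> lie in [0, 1], which
    leaves the constant 4.\<close>
  proof (cases "2 \<le> s")
    case False
    then have "?m * max 0 (s - 1) \<le> 1 * 1" using m by (intro mult_mono) auto
    then show ?thesis using m by (simp add: cutoff'_def abs_mult)
  qed (simp add: z)
qed

text \<open>With argument |x|^2 / R^2 the transition from 1 to 0 takes place between the radii R and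
  sqrt 2 R, inside the ball of radius 2 R on which the estimates are made.\<close>

lemma cutoff_inner_props:
  fixes x :: "real ^ 'n::finite"
  assumes R: "0 < R"
  shows "partially_C1 (\<lambda>x::real ^ 'n. cutoff ((x \<bullet> x) / R\<^sup>2))"
    and "partial k (\<lambda>x::real ^ 'n. cutoff ((x \<bullet> x) / R\<^sup>2))
      = (\<lambda>x. cutoff' ((x \<bullet> x) / R\<^sup>2) / R\<^sup>2 * (2 * x $ k))"
    and "2 * R \<le> norm x \<Longrightarrow> 2 \<le> (x \<bullet> x) / R\<^sup>2"
    and "norm x \<le> R \<Longrightarrow> (x \<bullet> x) / R\<^sup>2 \<le> 1"
proof -
  have d: "((\<lambda>s. cutoff (s / R\<^sup>2)) has_real_derivative cutoff' (s / R\<^sup>2) / R\<^sup>2) (at s)" for s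
    using DERIV_chain2[OF cutoff_deriv DERIV_cdivide[OF DERIV_ident]] by simp
  have c: "continuous_on UNIV (\<lambda>s. cutoff' (s / R\<^sup>2) / R\<^sup>2)"
    by (intro continuous_intros continuous_on_compose2[OF continuous_on_cutoff'[of UNIV]]) (use R in auto)
  show "partially_C1 (\<lambda>x::real ^ 'n. cutoff ((x \<bullet> x) / R\<^sup>2))"
    using partially_C1_compose[OF inner_self_partial(1) d c] .
  show "partial k (\<lambda>x::real ^ 'n. cutoff ((x \<bullet> x) / R\<^sup>2))
      = (\<lambda>x. cutoff' ((x \<bullet> x) / R\<^sup>2) / R\<^sup>2 * (2 * x $ k))"
    using partial_compose[OF inner_self_partial(1) d] by (simp add: inner_self_partial(2))
  show "2 \<le> (x \<bullet> x) / R\<^sup>2" if "2 * R \<le> norm x"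
  proof -
    have "(2 * R)\<^sup>2 \<le> (norm x)\<^sup>2" using that R by (intro power_mono) auto
    then have "2 * R\<^sup>2 \<le> x \<bullet> x" using R
      by (simp add: power2_norm_eq_inner power_mult_distrib) (smt (verit) zero_le_power2)
    then show ?thesis using R by (simp add: pos_le_divide_eq)
  qed
  show "(x \<bullet> x) / R\<^sup>2 \<le> 1" if "norm x \<le> R"
    using power_mono[OF that, of 2] R by (simp add: power2_norm_eq_inner pos_divide_le_eq)
qed

text \<open>Cutoff times \<open>F\<close> has compact support, so its divergence integrates to 0,
  and the product rule leaves only the integral of \<open>F\<close> against the gradient of the
  cutoff. That gradient is O(1/R) on a shell of volume O(R^n), where \<open>F\<close> is at most
  \<epsilon> R^(1-n). The powers of R cancel, so the bound does not depend on R.\<close>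

lemma integral_cutoff_divergence:
  fixes F :: "real ^ 'n::finite \<Rightarrow> real ^ 'n"
  assumes F: "\<And>k. partially_C1 (\<lambda>x. F x $ k)"
    and int: "integrable lborel (divergence F)"
    and R: "0 < R" and \<epsilon>: "0 \<le> \<epsilon>"
    and small: "\<And>x. R \<le> norm x \<Longrightarrow> norm (F x) \<le> \<epsilon> * norm x powr (1 - real CARD('n))"
  shows "\<bar>LINT x|lborel. cutoff ((x \<bullet> x) / R\<^sup>2) * divergence F x\<bar>
    \<le> 16 * 2 ^ CARD('n) * unit_ball_vol (real CARD('n)) * \<epsilon>"
proof -
  let ?\<chi> = "\<lambda>x::real ^ 'n. cutoff ((x \<bullet> x) / R\<^sup>2)"
  \<comment> \<open>The part of the product rule where the derivative falls on the cutoff;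
    \<open>2 * x $ k\<close> comes from the squared norm.\<close>
  define E where "E x = 2 * cutoff' ((x \<bullet> x) / R\<^sup>2) / R\<^sup>2 * (x \<bullet> F x)" for x
  note \<chi> = cutoff_inner_props[OF R]
  let ?P = "\<lambda>k x. partial k (\<lambda>x. ?\<chi> x * F x $ k) x"
  have P: "integrable lborel (?P k)" "(LINT x|lborel. ?P k x) = 0" for k
  proof -
    have "?\<chi> x * F x $ k = 0" if "2 * R \<le> norm x" for x
      using \<chi>(3)[OF that] by (simp add: cutoff_props)
    with integral_partial_compact_support[OF partially_C1_mult[OF \<chi>(1) F], of "2 * R" k k]
    show "integrable lborel (?P k)" "(LINT x|lborel. ?P k x) = 0" by auto
  qed
  have sumP: "(\<Sum>k\<in>UNIV. ?P k x) = E x + ?\<chi> x * divergence F x" for x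
    unfolding partial_mult[OF \<chi>(1) F] \<chi>(2) E_def divergence_def inner_vec_def[of x "F x"]
    by (simp add: sum.distrib sum_distrib_left sum_divide_distrib mult_ac)
  have "continuous_on UNIV (divergence F)"
    unfolding divergence_def[abs_def] by (intro continuous_intros partially_C1D(2) F)
  then have "(\<lambda>x. ?\<chi> x * divergence F x) \<in> borel_measurable borel"
    by (intro borel_measurable_continuous_onI continuous_on_mult partially_C1D(1)[OF \<chi>(1)])
  then have \<chi>_int: "integrable lborel (\<lambda>x. ?\<chi> x * divergence F x)"
    by (intro Bochner_Integration.integrable_bound[OF int])
      (auto simp: abs_mult intro!: mult_left_le_one_le cutoff_props(3))
  have "integrable lborel (\<lambda>x. (\<Sum>k\<in>UNIV. ?P k x) - ?\<chi> x * divergence F x)"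
    by (intro Bochner_Integration.integrable_diff Bochner_Integration.integrable_sum P \<chi>_int)
  then have E_int: "integrable lborel E"
    by (simp add: sumP)
  have "(LINT x|lborel. E x + ?\<chi> x * divergence F x) = 0"
    unfolding sumP[symmetric] by (subst Bochner_Integration.integral_sum) (auto simp: P)
  then have eq: "(LINT x|lborel. ?\<chi> x * divergence F x) = - (LINT x|lborel. E x)"
    using E_int \<chi>_int by simp
  \<comment> \<open>The factor 8 / R^2 bounds the coefficient in \<open>E\<close>, and |x| < 2 R on
    the shell turns it into 16 / R.\<close>
  define c where "c = 16 / R * (\<epsilon> * R powr (1 - real CARD('n)))"
  have c0: "0 \<le> c" using R \<epsilon> by (simp add: c_def)
  have E_bound: "\<bar>E x\<bar> \<le> c * indicator (ball 0 (2 * R)) x" for x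
  proof -
    consider "norm x \<le> R" | "2 * R \<le> norm x" | "R < norm x" "norm x < 2 * R" by linarith
    then show ?thesis
    proof cases
      case 3
      \<comment> \<open>The exponent is at most 0, so on the shell the bound is largest at the inner
        radius.\<close>
      have "norm x powr (1 - real CARD('n)) \<le> R powr (1 - real CARD('n))"
        using 3 R by (intro powr_mono2') (auto simp: Suc_le_eq)
      then have "norm (F x) \<le> \<epsilon> * R powr (1 - real CARD('n))"
        using small[of x] 3 \<epsilon> by (smt (verit) mult_left_mono)
      then have "norm x * norm (F x) \<le> (2 * R) * (\<epsilon> * R powr (1 - real CARD('n)))"
        using 3 R by (intro mult_mono) auto
      then have "\<bar>x \<bullet> F x\<bar> \<le> (2 * R) * (\<epsilon> * R powr (1 - real CARD('n)))"
        using Cauchy_Schwarz_ineq2[of x "F x"] by linarith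
      moreover have "\<bar>2 * cutoff' ((x \<bullet> x) / R\<^sup>2) / R\<^sup>2\<bar> \<le> 8 / R\<^sup>2"
        using cutoff_props(6)[of "(x \<bullet> x) / R\<^sup>2"] R by (simp add: abs_mult divide_right_mono)
      ultimately have "\<bar>E x\<bar> \<le> 8 / R\<^sup>2 * ((2 * R) * (\<epsilon> * R powr (1 - real CARD('n))))"
        unfolding E_def abs_mult[of _ "x \<bullet> F x"] by (intro mult_mono) auto
      also have "\<dots> = c" using R by (simp add: c_def power2_eq_square)
      finally show ?thesis using 3 by simp
    qed (use \<chi>(3,4)[of x] c0 in \<open>auto simp: E_def cutoff_props\<close>)
  qed
  have "\<bar>LINT x|lborel. E x\<bar> \<le> (LINT x|lborel. \<bar>E x\<bar>)"
    using integral_norm_bound[of lborel E] by simp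
  also have "\<dots> \<le> (LINT x|lborel. c * indicator (ball 0 (2 * R)) (x::real ^ 'n))"
    using emeasure_lborel_ball_finite[of 0 "2 * R"]
    by (intro integral_mono integrable_abs E_int integrable_mult_right integrable_real_indicator E_bound)
      auto
  also have "\<dots> = c * measure lborel (ball 0 (2 * R) :: (real ^ 'n) set)"
    by simp
  also have "\<dots> = c * (unit_ball_vol (real CARD('n)) * (2 * R) ^ CARD('n))"
    using R by (simp add: content_ball)
  also have "\<dots> = 16 * 2 ^ CARD('n) * unit_ball_vol (real CARD('n)) * \<epsilon>
      * (R powr (1 - real CARD('n)) * R ^ CARD('n) / R)"
    by (simp add: c_def power_mult_distrib)
  also have "R powr (1 - real CARD('n)) * R ^ CARD('n) / R = 1"
    using R by (simp add: powr_diff powr_realpow)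
  finally show ?thesis by (simp add: eq)
qed

text \<open>The cut-off integrals tend to the full integral by dominated convergence. They also tend
  to 0, because little-o decay makes \<epsilon> arbitrarily small in a bound uniform in the
  radius.\<close>

lemma integral_divergence_eq_0:
  fixes F :: "real ^ 'n::finite \<Rightarrow> real ^ 'n"
  assumes F: "\<And>k. partially_C1 (\<lambda>x. F x $ k)"
    and int: "integrable lborel (divergence F)"
    and decay: "(\<lambda>x. norm (F x)) \<in> o[at_infinity](\<lambda>x. norm x powr (1 - real CARD('n)))"
  shows "(LINT x|lborel. divergence F x) = 0"
proof -
  let ?I = "\<lambda>i. LINT x|lborel. cutoff ((x \<bullet> x) / (real (Suc i))\<^sup>2) * divergence F x"
  have cont: "continuous_on UNIV (divergence F)"
    unfolding divergence_def[abs_def] by (intro continuous_intros partially_C1D(2) F)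
  have "?I \<longlonglongrightarrow> (LINT x|lborel. divergence F x)"
  proof (rule integral_dominated_convergence[where w = "\<lambda>x. norm (divergence F x)"])
    show "divergence F \<in> borel_measurable lborel"
      using cont by (simp add: borel_measurable_continuous_onI)
    show "(\<lambda>x. cutoff ((x \<bullet> x) / (real (Suc i))\<^sup>2) * divergence F x) \<in> borel_measurable lborel" for i
      using cutoff_inner_props(1)[of "real (Suc i)"] cont
      by (auto intro!: borel_measurable_continuous_onI continuous_intros dest: partially_C1D(1))
    show "integrable lborel (\<lambda>x. norm (divergence F x))"
      using int by simp
    show "AE x in lborel. (\<lambda>i. cutoff ((x \<bullet> x) / (real (Suc i))\<^sup>2) * divergence F x)
        \<longlonglongrightarrow> divergence F x"
    proof (rule AE_I2, rule tendsto_eventually)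
      fix x :: "real ^ 'n"
      obtain N where N: "norm x \<le> real N" using real_arch_simple by blast
      show "\<forall>\<^sub>F i in sequentially. cutoff ((x \<bullet> x) / (real (Suc i))\<^sup>2) * divergence F x = divergence F x"
        using eventually_ge_at_top[of N]
      proof eventually_elim
        case (elim i)
        then have "norm x \<le> real (Suc i)" using N by linarith
        then show ?case using cutoff_inner_props(4)[of "real (Suc i)" x] by (simp add: cutoff_props)
      qed
    qed
    show "AE x in lborel. norm (cutoff ((x \<bullet> x) / (real (Suc i))\<^sup>2) * divergence F x)
        \<le> norm (divergence F x)" for i
      by (rule AE_I2) (simp add: abs_mult mult_left_le_one_le cutoff_props(3) del: of_nat_Suc)
  qed
  moreover have "?I \<longlonglongrightarrow> 0"
  proof (rule LIMSEQ_I)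
    fix e :: real assume e: "0 < e"
    define C where "C = 16 * 2 ^ CARD('n) * unit_ball_vol (real CARD('n))"
    have C: "0 \<le> C" by (simp add: C_def)
    \<comment> \<open>The denominator \<open>C + 1\<close> is positive from \<open>0 \<le> C\<close>
      alone and gives \<open>C * \<epsilon> < e\<close>.\<close>
    define \<epsilon> where "\<epsilon> = e / (C + 1)"
    have \<epsilon>: "0 < \<epsilon>" using C e by (simp add: \<epsilon>_def)
    have "\<forall>\<^sub>F x in at_infinity. norm (F x) \<le> \<epsilon> * norm x powr (1 - real CARD('n))"
      using landau_o.smallD[OF decay \<epsilon>] by simp
    then obtain b where b: "\<And>x. b \<le> norm x \<Longrightarrow> norm (F x) \<le> \<epsilon> * norm x powr (1 - real CARD('n))"
      by (auto simp: eventually_at_infinity)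
    obtain N where N: "b \<le> real N" using real_arch_simple by blast
    have "norm (?I i - 0) < e" if "N \<le> i" for i
    proof -
      have "\<bar>?I i\<bar> \<le> C * \<epsilon>"
        unfolding C_def using N that \<epsilon>
        by (intro integral_cutoff_divergence F int b) (auto simp del: of_nat_Suc)
      also have "\<dots> < e" using C e by (simp add: \<epsilon>_def field_simps)
      finally show ?thesis by simp
    qed
    then show "\<exists>N. \<forall>i\<ge>N. norm (?I i - 0) < e" by blast
  qed
  ultimately show ?thesis by (rule LIMSEQ_unique)
qed

subsection \<open>Green's identity for the generator\<close>

text \<open>Literally the field whose norm \<open>decaying_pair\<close> controls, so its decay
  follows by unfolding.\<close>

definition flux :: "(real ^ 'n::finite \<Rightarrow> real ^ 'n) \<Rightarrow> (real ^ 'n \<Rightarrow> real ^ 'n ^ 'n)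
    \<Rightarrow> (real ^ 'n \<Rightarrow> real) \<Rightarrow> (real ^ 'n \<Rightarrow> real) \<Rightarrow> real ^ 'n \<Rightarrow> real ^ 'n" where
  "flux b G u v x = (u x * v x) *\<^sub>R (b x - (1 / 2) *\<^sub>R mat_div G x)
     + (1 / 2) *\<^sub>R (G x *v (u x *\<^sub>R gradient v x - v x *\<^sub>R gradient u x))"

text \<open>By the product rule, the terms with \<open>mat_div G\<close> and the gradient of
  \<open>u\<close> merge into v div(u G). One more divergence then produces the term div^2(u G) of
  the adjoint generator.\<close>

lemma flux_component:
  fixes u :: "real ^ 'n::finite \<Rightarrow> real"
  assumes u: "partially_C2 u" and G: "\<And>j k. partially_C2 (\<lambda>x. G x $ j $ k)"
  shows "flux b G u v x $ j = v x * (u x * b x $ j)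
     + (- 1 / 2) * (v x * (\<Sum>k\<in>UNIV. partial k (\<lambda>y. u y * G y $ j $ k) x))
     + 1 / 2 * (\<Sum>k\<in>UNIV. (u x * G x $ j $ k) * partial k v x)"
  by (simp add: flux_def mat_div_def gradient_def matrix_vector_mult_def
      partial_mult[OF partially_C2D(1)[OF u] partially_C2D(1)[OF G]]
      sum.distrib sum_subtractf sum_distrib_left sum_negf algebra_simps)

text \<open>With opaque functions the product rule stops at the outer level: the products u b and u
  G stay whole and can be matched with \<open>adjoint_generator\<close>.\<close>

lemma partial_flux_form:
  assumes "partially_C1 v" "partially_C1 a" "partially_C1 w"
    "\<And>i. partially_C1 (z i)" "\<And>i. partially_C1 (y i)"
  shows "partial k (\<lambda>x. v x * a x + c * (v x * w x) + d * (\<Sum>i\<in>I. z i x * y i x)) x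
    = partial k v x * a x + v x * partial k a x + c * (partial k v x * w x + v x * partial k w x)
      + d * (\<Sum>i\<in>I. partial k (z i) x * y i x + z i x * partial k (y i) x)"
  using assms
  by (simp add: partial_add partial_mult partial_sum partial_const partially_C1_add
      partially_C1_mult partially_C1_sum partially_C1_const)

lemma frobenius_eq_sum: "frobenius M N = (\<Sum>j\<in>UNIV. \<Sum>k\<in>UNIV. M $ j $ k * N $ j $ k)"
  unfolding frobenius_def trace_def matrix_matrix_mult_def transpose_def
  by simp (rule sum.swap)

text \<open>Derivatives falling on \<open>v\<close> build the generator, those falling on u b and
  div(u G) build the adjoint, and the mixed first-order terms cancel. Mixed partials occur in the
  same order as in \<open>mat_div2\<close> and \<open>hessian\<close>, so they are never
  interchanged.\<close>

lemma divergence_flux: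
  fixes u :: "real ^ 'n::finite \<Rightarrow> real"
  assumes b: "\<And>j. partially_C1 (\<lambda>x. b x $ j)"
    and G: "\<And>j k. partially_C2 (\<lambda>x. G x $ j $ k)" and sym: "\<And>x j k. G x $ j $ k = G x $ k $ j"
    and u: "partially_C2 u" and v: "partially_C2 v"
  shows "partially_C1 (\<lambda>x. flux b G u v x $ j)"
    and "divergence (flux b G u v) x = u x * generator b G v x - v x * adjoint_generator b G u x"
proof -
  note pC1 = partially_C1_add partially_C1_mult partially_C1_const partially_C1_sum
    partially_C2D(1)[OF u] partially_C2D(1)[OF v] partially_C2D(1)[OF G] b
    partially_C2D(2)[OF v] partially_C2D(2)[OF partially_C2_mult[OF u G]]
  show "partially_C1 (\<lambda>x. flux b G u v x $ j)"
    unfolding flux_component[OF u G] by (intro pC1)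
  have d: "partial j (\<lambda>x. flux b G u v x $ j) x =
      partial j v x * (u x * b x $ j) + v x * partial j (\<lambda>x. u x * b x $ j) x
     + (- 1 / 2) * (partial j v x * (\<Sum>k\<in>UNIV. partial k (\<lambda>y. u y * G y $ j $ k) x)
         + v x * (\<Sum>k\<in>UNIV. partial j (partial k (\<lambda>y. u y * G y $ j $ k)) x))
     + 1 / 2 * (\<Sum>k\<in>UNIV. partial j (\<lambda>y. u y * G y $ j $ k) x * partial k v x
         + (u x * G x $ j $ k) * partial j (partial k v) x)" for j
    unfolding flux_component[OF u G]
    by (subst partial_flux_form) (intro pC1 | simp add: partial_sum pC1)+
  \<comment> \<open>The two first-order cross terms carry opposite signs; symmetry of
    \<open>G\<close> makes them equal after exchanging the indices.\<close>
  have swap: "(\<Sum>j\<in>UNIV. partial j v x * (\<Sum>k\<in>UNIV. partial k (\<lambda>y. u y * G y $ j $ k) x))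
      = (\<Sum>j\<in>UNIV. \<Sum>k\<in>UNIV. partial j (\<lambda>y. u y * G y $ j $ k) x * partial k v x)"
    unfolding sum_distrib_left by (subst sum.swap) (simp add: sym mult.commute)
  show "divergence (flux b G u v) x = u x * generator b G v x - v x * adjoint_generator b G u x"
    unfolding divergence_def d sum.distrib sum_distrib_left[symmetric] swap
    by (simp add: generator_def adjoint_generator_def divergence_def mat_div2_def frobenius_eq_sum
        hessian_def gradient_def inner_vec_def sum.distrib sum_distrib_left sum_negf algebra_simps)
qed


lemma integral_generator_eq_0:
  fixes u :: "real ^ 'n::finite \<Rightarrow> real"
  assumes b: "\<And>j. partially_C1 (\<lambda>x. b x $ j)"
    and G: "\<And>j k. partially_C2 (\<lambda>x. G x $ j $ k)" and sym: "\<And>x j k. G x $ j $ k = G x $ k $ j"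
    and inv: "\<And>x. adjoint_generator b G u x = 0" and decay: "decaying_pair b G u v"
    and int: "integrable lborel (\<lambda>x. u x * generator b G v x)"
  shows "(LINT x|lborel. u x * generator b G v x) = 0"
proof -
  have u: "partially_C2 u" and v: "partially_C2 v"
    using decay by (auto simp: decaying_pair_def C2_imp_partially_C2)
  have eq: "divergence (flux b G u v) = (\<lambda>x. u x * generator b G v x)"
    using divergence_flux(2)[OF b G sym u v] by (simp add: fun_eq_iff inv)
  show ?thesis
    using integral_divergence_eq_0[OF divergence_flux(1)[OF b G sym u v]] int decay
    unfolding eq by (simp add: decaying_pair_def flux_def)
qed

section \<open>The diffusion quadratic form and the generator on exponentials\<close>

lemma transpose_matrix_vector_inner:
  fixes A :: "real ^ 'm::finite ^ 'n::finite"
  shows "(A *v y) \<bullet> z = y \<bullet> (transpose A *v z)"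
  by (metis dot_lmul_matrix inner_commute transpose_matrix_vector)

text \<open>Adjointness moves one factor of D = g g^T across the inner product. This identifies the
  quadratic term of \<open>generator_exp\<close> as a squared norm.\<close>

lemma norm_transpose_diffusion:
  "(norm (transpose (g x) *v z))\<^sup>2
    = (\<Sum>j\<in>UNIV. \<Sum>k\<in>UNIV. diffusion_matrix g x $ j $ k * (z $ j * z $ k))"
proof -
  have "(norm (transpose (g x) *v z))\<^sup>2 = z \<bullet> (diffusion_matrix g x *v z)"
    unfolding power2_norm_eq_inner diffusion_matrix_def
    by (metis inner_commute matrix_vector_mul_assoc transpose_matrix_vector_inner)
  then show ?thesis
    by (simp add: inner_vec_def matrix_vector_mult_def sum_distrib_left mult_ac)
qed

text \<open>Besides the Hessian of \<eta>, the second derivatives of exp(\<eta>) contain the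
  products of its first derivatives. Paired with D, these give the squared norm.\<close>

lemma generator_exp:
  fixes \<eta> :: "real ^ 'n::finite \<Rightarrow> real" and g :: "real ^ 'n \<Rightarrow> real ^ 'm::finite ^ 'n"
  assumes \<eta>: "partially_C2 \<eta>"
  shows "generator b (diffusion_matrix g) (\<lambda>x. exp (\<eta> x)) x
    = exp (\<eta> x) * (generator b (diffusion_matrix g) \<eta> x
        + 1 / 2 * (norm (transpose (g x) *v gradient \<eta> x))\<^sup>2)"
proof -
  note \<eta>1 = partially_C2D(1)[OF \<eta>] and \<eta>2 = partially_C2D(2)[OF \<eta>]
  have p1: "partial k (\<lambda>x. exp (\<eta> x)) = (\<lambda>x. exp (\<eta> x) * partial k \<eta> x)" for k
    by (rule partial_compose[OF \<eta>1 DERIV_exp])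
  have "partially_C1 (\<lambda>x. exp (\<eta> x))"
    by (rule partially_C1_compose[OF \<eta>1 DERIV_exp]) (intro continuous_intros)
  then have p2: "partial j (partial k (\<lambda>x. exp (\<eta> x))) x
      = exp (\<eta> x) * (partial j \<eta> x * partial k \<eta> x + partial j (partial k \<eta>) x)" for j k
    by (simp add: p1 partial_mult[OF _ \<eta>2] algebra_simps)
  show ?thesis
    unfolding norm_transpose_diffusion generator_def frobenius_eq_sum hessian_def gradient_def inner_vec_def
    by (simp add: p2) (simp add: p1 sum.distrib sum_distrib_left sum_divide_distrib algebra_simps)
qed

text \<open>Supplies the measurability with which integrability passes from |L(ln r)| to L(ln
  r).\<close>

lemma continuous_on_generator:
  assumes "\<And>j. continuous_on UNIV (\<lambda>x. b x $ j)" "\<And>j k. continuous_on UNIV (\<lambda>x. G x $ j $ k)"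
    and \<eta>: "partially_C2 \<eta>"
  shows "continuous_on UNIV (generator b G \<eta>)"
  unfolding generator_def[abs_def] frobenius_eq_sum hessian_def gradient_def inner_vec_def
  by (intro continuous_on_add continuous_on_mult continuous_on_sum continuous_on_const assms
      partially_C1D(2)[OF partially_C2D(1)[OF \<eta>]] partially_C1D(2)[OF partially_C2D(2)[OF \<eta>]]
    | simp)+

subsection \<open>The moment inequality\<close>

theorem theorem3:
  fixes f :: "real ^ 'n \<Rightarrow> real ^ 'n"
    and g :: "real ^ 'n \<Rightarrow> real ^ 'm ^ 'n"
    and h :: "real ^ 'n \<Rightarrow> real ^ 'm"
    and p p0 :: "real ^ 'n \<Rightarrow> real"
  assumes "C1 f" and "C2 g" and "C1 h"
    and "\<exists>L. L-lipschitz_on UNIV f"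
    and "\<exists>L. L-lipschitz_on UNIV g"
    and "\<exists>L. L-lipschitz_on UNIV h"
    and "\<exists>L. L-lipschitz_on UNIV (perturbed_drift f g h)"
    and "unique_invariant_pdf (perturbed_drift f g h) (diffusion_matrix g) p"
    and "unique_invariant_pdf f (diffusion_matrix g) p0"
    and "\<forall>x. 0 < p x" and "\<forall>x. 0 < p0 x"
    and "has_finite_mean p (\<lambda>x. \<bar>generator (perturbed_drift f g h) (diffusion_matrix g)
           (\<lambda>y. ln (density_ratio p p0 y)) x\<bar>)"
    and "has_finite_mean p (\<lambda>x. (norm (h x))\<^sup>2)"
    and "has_finite_mean p (\<lambda>x. (norm (psi g p p0 x))\<^sup>2)"
    and "decaying_pair (perturbed_drift f g h) (diffusion_matrix g)
           p (\<lambda>x. ln (density_ratio p p0 x))"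
    and "decaying_pair f (diffusion_matrix g) p0 (density_ratio p p0)"
  shows "mean p (\<lambda>x. (norm (psi g p p0 x))\<^sup>2) \<le> 4 * mean p (\<lambda>x. (norm (h x))\<^sup>2)"
proof -
  let ?D = "diffusion_matrix g" and ?b = "perturbed_drift f g h"
  define \<eta> where "\<eta> = (\<lambda>x. ln (density_ratio p p0 x))"
  define \<psi> where "\<psi> = psi g p p0"
  let ?L = "generator ?b ?D \<eta>"
  have f: "partially_C1 (\<lambda>x. f x $ j)" for j
    by (intro C1_imp_partially_C1 C1_bounded_linear[OF assms(1)] bounded_linear_vec_nth)
  have h: "partially_C1 (\<lambda>x. h x $ l)" for l
    by (intro C1_imp_partially_C1 C1_bounded_linear[OF assms(3)] bounded_linear_vec_nth)
  have g: "partially_C2 (\<lambda>x. g x $ j $ l)" for j l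
    by (intro C2_imp_partially_C2 C2_bounded_linear[OF assms(2)]
        bounded_linear_compose[OF bounded_linear_vec_nth] bounded_linear_vec_nth)
  have b: "partially_C1 (\<lambda>x. ?b x $ j)" for j
    by (simp add: perturbed_drift_def matrix_vector_mult_def)
      (intro partially_C1_add partially_C1_sum partially_C1_mult f h partially_C2D(1)[OF g])
  have D: "partially_C2 (\<lambda>x. ?D x $ j $ k)" for j k
    by (simp add: diffusion_matrix_def matrix_matrix_mult_def transpose_def)
      (intro partially_C2_sum partially_C2_mult g)
  have sym: "?D x $ j $ k = ?D x $ k $ j" for x j k
    by (simp add: diffusion_matrix_def matrix_matrix_mult_def transpose_def mult.commute)
  have inv: "adjoint_generator ?b ?D p x = 0" "adjoint_generator f ?D p0 x = 0" for x
    using assms(8,9) by (auto simp: unique_invariant_pdf_def invariant_pdf_def)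
  have pos: "0 < p x" "0 < p0 x" for x using assms(10,11) by auto
  \<comment> \<open>Regularity of ln r is part of the first decay hypothesis; writing r as
    exp(\<eta>) below avoids differentiating a quotient or a logarithm.\<close>
  have p: "partially_C2 p" and \<eta>: "partially_C2 \<eta>"
    using assms(15) by (auto simp: decaying_pair_def \<eta>_def C2_imp_partially_C2)
  have \<psi>_eq: "\<psi> x = transpose (g x) *v gradient \<eta> x" for x
    by (simp add: \<psi>_def psi_def \<eta>_def)
  have ratio: "density_ratio p p0 = (\<lambda>x. exp (\<eta> x))"
    using pos by (auto simp: \<eta>_def density_ratio_def)
  have p_eq: "p0 x * exp (\<eta> x) = p x" for x
    using pos[of x] by (simp add: \<eta>_def density_ratio_def)
  \<comment> \<open>The two drifts differ by g h, and g h paired with the gradient of \<eta> equals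
    h paired with \<psi>.\<close>
  have Lf: "generator f ?D \<eta> x = ?L x - h x \<bullet> \<psi> x" for x
    by (simp add: generator_def perturbed_drift_def inner_add_left transpose_matrix_vector_inner \<psi>_eq)
  have key: "p0 x * generator f ?D (density_ratio p p0) x
      = p x * ?L x - (h x \<bullet> \<psi> x) * p x + 1 / 2 * ((norm (\<psi> x))\<^sup>2 * p x)" for x
    unfolding ratio generator_exp[OF \<eta>] \<psi>_eq[symmetric] Lf p_eq[symmetric]
    by (simp add: algebra_simps)
  have cont: "continuous_on UNIV ?L" "continuous_on UNIV p" "continuous_on UNIV (\<lambda>x. h x \<bullet> \<psi> x)"
    unfolding \<psi>_eq inner_vec_def matrix_vector_mult_def transpose_def gradient_def
    using partially_C1D(1)[OF b] partially_C1D(1)[OF partially_C2D(1)[OF D]]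
      partially_C1D(1)[OF partially_C2D(1)[OF p]] partially_C1D(1)[OF h]
      partially_C1D(1)[OF partially_C2D(1)[OF g]] partially_C1D(2)[OF partially_C2D(1)[OF \<eta>]]
    by (auto intro!: continuous_on_generator \<eta> continuous_on_sum continuous_on_mult)
  have int_h: "integrable lborel (\<lambda>x. (norm (h x))\<^sup>2 * p x)"
    and int_\<psi>: "integrable lborel (\<lambda>x. (norm (\<psi> x))\<^sup>2 * p x)"
    using assms(13,14) by (auto simp: has_finite_mean_def \<psi>_def)
  have "integrable lborel (\<lambda>x. \<bar>?L x\<bar> * p x)"
    using assms(12) by (simp add: has_finite_mean_def \<eta>_def)
  then have int_L: "integrable lborel (\<lambda>x. p x * ?L x)"
    by (rule Bochner_Integration.integrable_bound)
      (use cont in \<open>auto intro!: borel_measurable_continuous_onI continuous_intros simp: abs_mult\<close>)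
  \<comment> \<open>Expands (|h| - |\<psi>|/2)^2 \<ge> 0. With weight 1/4, doubling the bound leaves
    half of E|\<psi>|^2 to absorb on the left, which yields the constant 4.\<close>
  have young: "\<bar>h x \<bullet> \<psi> x\<bar> \<le> (norm (h x))\<^sup>2 + 1 / 4 * (norm (\<psi> x))\<^sup>2" for x
  proof -
    have "0 \<le> (norm (h x) - norm (\<psi> x) / 2)\<^sup>2" by simp
    then have "norm (h x) * norm (\<psi> x) \<le> (norm (h x))\<^sup>2 + 1 / 4 * (norm (\<psi> x))\<^sup>2"
      by (simp add: power2_diff power_divide)
    with Cauchy_Schwarz_ineq2[of "h x" "\<psi> x"] show ?thesis by linarith
  qed
  have young_p: "\<bar>(h x \<bullet> \<psi> x) * p x\<bar> \<le> (norm (h x))\<^sup>2 * p x + 1 / 4 * ((norm (\<psi> x))\<^sup>2 * p x)" for x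
    using mult_right_mono[OF young[of x] less_imp_le[OF pos(1)[of x]]] pos(1)[of x]
    by (simp add: abs_mult algebra_simps)
  have int_bound: "integrable lborel (\<lambda>x. (norm (h x))\<^sup>2 * p x + 1 / 4 * ((norm (\<psi> x))\<^sup>2 * p x))"
    using int_h int_\<psi> by simp
  \<comment> \<open>Young's bound doubles as the dominating function, so no separate moment of h
    paired with \<psi> has to be assumed.\<close>
  then have int_h\<psi>: "integrable lborel (\<lambda>x. (h x \<bullet> \<psi> x) * p x)"
  proof (rule Bochner_Integration.integrable_bound)
    show "(\<lambda>x. (h x \<bullet> \<psi> x) * p x) \<in> borel_measurable lborel"
      using cont by (simp add: borel_measurable_continuous_onI continuous_on_mult)
    show "AE x in lborel. norm ((h x \<bullet> \<psi> x) * p x)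
        \<le> norm ((norm (h x))\<^sup>2 * p x + 1 / 4 * ((norm (\<psi> x))\<^sup>2 * p x))"
      by (rule AE_I2) (use young_p in \<open>auto intro: order_trans[OF _ abs_ge_self]\<close>)
  qed
  have 1: "(LINT x|lborel. p x * ?L x) = 0"
    using integral_generator_eq_0[OF b D sym inv(1) assms(15)[folded \<eta>_def] int_L] .
  \<comment> \<open>Integrability for the nominal system is inherited through \<open>key\<close>
    from three terms integrable against \<open>p\<close>.\<close>
  have "integrable lborel (\<lambda>x. p0 x * generator f ?D (density_ratio p p0) x)"
    unfolding key using int_L int_h\<psi> int_\<psi> by simp
  then have "(LINT x|lborel. p0 x * generator f ?D (density_ratio p p0) x) = 0"
    by (rule integral_generator_eq_0[OF f D sym inv(2) assms(16)])
  then have 2: "(LINT x|lborel. (norm (\<psi> x))\<^sup>2 * p x) = 2 * (LINT x|lborel. (h x \<bullet> \<psi> x) * p x)"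
    unfolding key using int_L int_h\<psi> int_\<psi> 1 by simp
  have "(LINT x|lborel. (h x \<bullet> \<psi> x) * p x)
      \<le> (LINT x|lborel. (norm (h x))\<^sup>2 * p x + 1 / 4 * ((norm (\<psi> x))\<^sup>2 * p x))"
    using young_p by (intro integral_mono int_h\<psi> int_bound) (auto intro: order_trans[OF abs_ge_self])
  also have "\<dots> = (LINT x|lborel. (norm (h x))\<^sup>2 * p x) + 1 / 4 * (LINT x|lborel. (norm (\<psi> x))\<^sup>2 * p x)"
    using int_h int_\<psi> by simp
  \<comment> \<open>With A = E|\<psi>|^2 and B = E|h|^2, the identity \<open>2\<close> gives A \<le>
    2 B + A / 2; A is finite, so A \<le> 4 B.\<close>
  finally show ?thesis
    using 2 by (simp add: mean_def \<psi>_def)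
qed

end
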